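(* Let $p$ be an AHI polynomial in $n$ variables that is non-negative on $\mathbb{R}^n$, and let $2D$ be an even integer with $\deg p\le 2D$. Then $p$ is simultaneously a sum of squares and a sum of non-negative circuit polynomials: $p\in\Sigma_{n,2D}\cap\mathcal{C}_{n,2D}$.
   Context: AHI polynomials: a polynomial in $n$ variables is an AHI polynomial if it has the form $p(x)=\big(\sum_{i=1}^n \lambda_i x^{\alpha(i)}\big)\big(\sum_{i=1}^n \lambda_i \prod_{j\neq i} x^{\alpha(j)}\big)-c\prod_{i=1}^n x^{\alpha(i)}$ with $\lambda_i\ge 0$, $c\in\mathbb{R}$, and each $x^{\alpha(i)}$ a squared monomial in $x_1,\dots,x_n$ (all exponents even non-negative integers). $\Sigma_{n,2D}$ is the cone of polynomials in $n$ variables of degree at most $2D$ that are sums of squares of polynomials. Circuit polynomials: a circuit polynomial is a polynomial $g=\sum_{j=0}^m b_jx^{a(j)}+c'x^{y}$ where $a(0),\dots,a(m)\in(2\mathbb{Z}_{\ge0})^n$ are affinely independent, $b_j>0$, $c'\in\mathbb{R}$, and $y\in\mathbb{Z}_{\ge 0}^n$ lies in the relative interior of the simplex $\operatorname{conv}\{a(0),\dots,a(m)\}$; monomial squares $b\,x^{a}$ with $b>0$, $a\in(2\mathbb{Z}_{\ge0})^n$ are included as a degenerate case. The SONC cone $\mathcal{C}_{n,2D}$ is the set of finite non-negative linear combinations of circuit polynomials in $n$ variables of degree at most $2D$ that are non-negative on $\mathbb{R}^n$. *)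

theory Defs
  imports "HOL-Analysis.Analysis" "HOL-Library.Poly_Mapping"
begin

text \<open>
  Real polynomials in \<open>n = CARD('n)\<close> variables, as finitely supported functions from exponent
  vectors to coefficients; the ring operations are the convolution ones of \<open>Poly_Mapping\<close>.
\<close>

type_synonym 'n expo = "'n \<Rightarrow>\<^sub>0 nat"
type_synonym 'n mpoly = "('n \<Rightarrow>\<^sub>0 nat) \<Rightarrow>\<^sub>0 real"

definition const :: "real \<Rightarrow> 'n mpoly" where
  "const c = Poly_Mapping.single 0 c"

definition mon :: "'n expo \<Rightarrow> 'n mpoly" where
  "mon a = Poly_Mapping.single a 1"

definition peval :: "'n::finite mpoly \<Rightarrow> real ^ 'n \<Rightarrow> real" where
  "peval p x = (\<Sum>a\<in>Poly_Mapping.keys p.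
     Poly_Mapping.lookup p a * (\<Prod>i\<in>UNIV. (x $ i) ^ Poly_Mapping.lookup a i))"

definition nonneg_poly :: "'n::finite mpoly \<Rightarrow> bool" where
  "nonneg_poly p \<longleftrightarrow> (\<forall>x. peval p x \<ge> 0)"

definition expo_deg :: "'n::finite expo \<Rightarrow> nat" where
  "expo_deg a = (\<Sum>i\<in>UNIV. Poly_Mapping.lookup a i)"

text \<open>Total degree; the zero polynomial gets degree \<open>0\<close>.\<close>

definition total_deg :: "'n::finite mpoly \<Rightarrow> nat" where
  "total_deg p = Max (insert 0 (expo_deg ` Poly_Mapping.keys p))"

definition even_expo :: "'n expo \<Rightarrow> bool" where
  "even_expo a \<longleftrightarrow> (\<forall>i. even (Poly_Mapping.lookup a i))"

definition expo_vec :: "'n::finite expo \<Rightarrow> real ^ 'n" where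
  "expo_vec a = (\<chi> i. real (Poly_Mapping.lookup a i))"

text \<open>
  The number of squared monomials equals the number of variables, so both are indexed by \<open>'n\<close>.
  The monomials need not be distinct.
\<close>

definition AHI :: "'n::finite mpoly \<Rightarrow> bool" where
  "AHI p \<longleftrightarrow> (\<exists>(l :: 'n \<Rightarrow> real) (c :: real) (\<alpha> :: 'n \<Rightarrow> 'n expo).
     (\<forall>i. l i \<ge> 0) \<and> (\<forall>i. even_expo (\<alpha> i)) \<and>
     p = (\<Sum>i\<in>UNIV. const (l i) * mon (\<alpha> i))
           * (\<Sum>i\<in>UNIV. const (l i) * (\<Prod>j\<in>UNIV - {i}. mon (\<alpha> j)))
         - const c * (\<Prod>i\<in>UNIV. mon (\<alpha> i)))"

definition sos_cone :: "nat \<Rightarrow> 'n::finite mpoly set" where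
  "sos_cone d = {p. total_deg p \<le> d \<and>
     (\<exists>(k :: nat) (q :: nat \<Rightarrow> 'n mpoly). p = (\<Sum>j<k. (q j)\<^sup>2))}"

text \<open>
  The affinely independent exponents \<open>a(0), \<dots>, a(m)\<close> are given as a finite set \<open>A\<close>
  (\<open>expo_vec\<close> is injective, and an affinely independent family has no repetitions);
  \<open>A\<close> is nonempty because it has a point in the relative interior of its convex hull.
\<close>

definition circuit_poly :: "'n::finite mpoly \<Rightarrow> bool" where
  "circuit_poly g \<longleftrightarrow>
     (\<exists>(A :: 'n expo set) (b :: 'n expo \<Rightarrow> real) (c :: real) (y :: 'n expo).
        finite A \<and> (\<forall>a\<in>A. even_expo a) \<and> \<not> affine_dependent (expo_vec ` A) \<and>
        (\<forall>a\<in>A. b a > 0) \<and>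
        expo_vec y \<in> rel_interior (convex hull (expo_vec ` A)) \<and>
        g = (\<Sum>a\<in>A. const (b a) * mon a) + const c * mon y)
   \<or> (\<exists>(a :: 'n expo) (b :: real). even_expo a \<and> b > 0 \<and> g = const b * mon a)"

definition sonc_cone :: "nat \<Rightarrow> 'n::finite mpoly set" where
  "sonc_cone d = {p. \<exists>(k :: nat) (\<mu> :: nat \<Rightarrow> real) (g :: nat \<Rightarrow> 'n mpoly).
     (\<forall>j<k. \<mu> j \<ge> 0 \<and> circuit_poly (g j) \<and> total_deg (g j) \<le> d \<and> nonneg_poly (g j)) \<and>
     p = (\<Sum>j<k. const (\<mu> j) * g j)}"

end

theory Submission
  imports Defs
begin

text \<open>
  Write \<open>M\<^sub>i\<close> for the squared monomials, \<open>P\<close> for their product and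
  \<open>E i k = M\<^sub>i * (\<Prod>j \<noteq> k. M\<^sub>j)\<close>. Expanding the product in an AHI polynomial and pairing the
  term at \<open>(i, k)\<close> with the one at \<open>(k, i)\<close> gives

  \<open>p = (\<Sum>i k. l\<^sub>i l\<^sub>k / 2 * (E i k + E k i - 2 P)) + ((\<Sum>i. l\<^sub>i)\<^sup>2 - c) P\<close>.

  Every bracket vanishes at the all-ones point and \<open>P\<close> is \<open>1\<close> there, so non-negativity of \<open>p\<close> at
  this single point already forces \<open>c \<le> (\<Sum>i. l\<^sub>i)\<^sup>2\<close>. Since \<open>E i k * E k i = P\<^sup>2\<close> and the
  exponents of \<open>E i k\<close> and \<open>E k i\<close> are even, a bracket is the square of a difference of two
  monomials. It is also a circuit polynomial supported on a segment with the exponent of \<open>P\<close> as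
  midpoint (or zero, if the two ends coincide). Both memberships are read off from this one
  decomposition (\<open>AHI_decomposition\<close>), abstracted as a weighted family of segments with a common
  midpoint (\<open>common_midpoint\<close>).

  For the SONC cone every summand must moreover respect the degree bound. The only exponent at
  which the decomposition can cancel is that of \<open>P\<close>. Hence the ends of every proper segment that
  occurs with positive weight are exponents of \<open>p\<close>, and the degree of the midpoint is the mean of
  the degrees of the ends. The leftover multiple of \<open>P\<close> either survives in \<open>p\<close> or is cancelled by some
  proper segment with positive weight, whose midpoint is the exponent of \<open>P\<close>.
\<close>

section \<open>Constants, monomials and evaluation\<close>

lemma const_mult_mon: "const c * mon a = Poly_Mapping.single a c"
  by (simp add: const_def mon_def mult_single)

lemma lookup_const_mult:
  "Poly_Mapping.lookup (const c * p) a = c * Poly_Mapping.lookup p a"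
proof -
  have "const c * p = Poly_Mapping.map ((*) c) p"
    by (simp add: const_def mult_map_scale_conv_mult)
  then show ?thesis
    by (simp add: Poly_Mapping.map.rep_eq when_def)
qed

lemma const_0 [simp]: "const 0 = 0"
  by (simp add: const_def)

lemma const_1 [simp]: "const 1 = 1"
  by (simp add: const_def)

lemma const_add: "const (a + b) = const a + const b"
  by (simp add: const_def single_add)

lemma const_uminus: "const (- a) = - const a"
  by (simp add: const_def single_uminus)

lemma const_mult: "const (a * b) = const a * const b"
  by (simp add: const_def mult_single)

lemma const_sum: "const (sum f S) = (\<Sum>s\<in>S. const (f s))"
  by (induction S rule: infinite_finite_induct) (simp_all add: const_add)

lemma mon_add: "mon (a + b) = mon a * mon b"
  by (simp add: mon_def mult_single)

lemma mon_sum: "mon (sum f S) = (\<Prod>s\<in>S. mon (f s))"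
  by (induction S rule: infinite_finite_induct) (simp_all add: mon_add, simp_all add: mon_def)

definition mon_val :: "'n::finite expo \<Rightarrow> real ^ 'n \<Rightarrow> real" where
  "mon_val a x = (\<Prod>i\<in>UNIV. (x $ i) ^ Poly_Mapping.lookup a i)"

lemma mon_val_add: "mon_val (a + b) x = mon_val a x * mon_val b x"
  by (simp add: mon_val_def lookup_add power_add prod.distrib)

lemma mon_val_ones [simp]: "mon_val a (\<chi> i. 1) = 1"
  by (simp add: mon_val_def)

lemma peval_superset:
  assumes "finite K" "Poly_Mapping.keys p \<subseteq> K"
  shows "peval p x = (\<Sum>a\<in>K. Poly_Mapping.lookup p a * mon_val a x)"
  unfolding peval_def mon_val_def
  by (rule sum.mono_neutral_left) (use assms in \<open>auto simp: in_keys_iff\<close>)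

lemma peval_add: "peval (p + q) x = peval p x + peval q x"
proof -
  let ?K = "Poly_Mapping.keys p \<union> Poly_Mapping.keys q"
  have "peval r x = (\<Sum>a\<in>?K. Poly_Mapping.lookup r a * mon_val a x)"
    if "r \<in> {p, q, p + q}" for r
    by (rule peval_superset) (use that Poly_Mapping.keys_add[of p q] in auto)
  then show ?thesis
    by (simp add: lookup_add distrib_right sum.distrib)
qed

lemma peval_const_mult: "peval (const c * p) x = c * peval p x"
proof -
  have "peval r x = (\<Sum>a\<in>Poly_Mapping.keys p. Poly_Mapping.lookup r a * mon_val a x)"
    if "r \<in> {p, const c * p}" for r
    by (rule peval_superset) (use that in \<open>auto simp: in_keys_iff lookup_const_mult\<close>)
  then show ?thesis
    by (simp add: lookup_const_mult sum_distrib_left mult.assoc)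
qed

lemma peval_mon: "peval (mon a) x = mon_val a x"
  by (subst peval_superset[where K = "{a}"]) (simp_all add: mon_def)

lemma peval_sum: "peval (sum f S) x = (\<Sum>s\<in>S. peval (f s) x)"
  by (induction S rule: infinite_finite_induct) (simp_all add: peval_add, simp_all add: peval_def)

section \<open>Even exponents and degrees\<close>

lemma even_expo_half:
  assumes "even_expo a"
  obtains h where "a = h + h"
proof -
  have "Poly_Mapping.lookup a i div 2 + Poly_Mapping.lookup a i div 2 = Poly_Mapping.lookup a i"
    for i
    using assms by (simp add: even_expo_def flip: mult_2)
  then have "a = Poly_Mapping.map (\<lambda>m. m div 2) a + Poly_Mapping.map (\<lambda>m. m div 2) a"
    by (intro poly_mapping_eqI) (simp add: lookup_add Poly_Mapping.map.rep_eq when_def)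
  then show thesis by (rule that)
qed

lemma even_expo_add: "even_expo a \<Longrightarrow> even_expo b \<Longrightarrow> even_expo (a + b)"
  by (simp add: even_expo_def lookup_add)

lemma even_expo_sum: "(\<And>s. s \<in> S \<Longrightarrow> even_expo (f s)) \<Longrightarrow> even_expo (sum f S)"
  by (induction S rule: infinite_finite_induct)
    (auto intro: even_expo_add simp: even_expo_def[of 0])

lemma expo_double_cancel:
  assumes "(a::'n expo) + a = b + b"
  shows "a = b"
proof (rule poly_mapping_eqI)
  fix i
  show "Poly_Mapping.lookup a i = Poly_Mapping.lookup b i"
    using arg_cong[OF assms, of "\<lambda>c. Poly_Mapping.lookup c i"] by (simp add: lookup_add)
qed

lemma expo_deg_add: "expo_deg (a + b) = expo_deg a + expo_deg b"
  by (simp add: expo_deg_def lookup_add sum.distrib)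

lemma expo_deg_le_total_deg: "a \<in> Poly_Mapping.keys p \<Longrightarrow> expo_deg a \<le> total_deg p"
  by (simp add: total_deg_def)

lemma total_deg_le: "(\<And>a. a \<in> Poly_Mapping.keys p \<Longrightarrow> expo_deg a \<le> d) \<Longrightarrow> total_deg p \<le> d"
  by (auto simp: total_deg_def)

section \<open>Binomial squares as circuit polynomials\<close>

text \<open>
  With \<open>u\<close> and \<open>v\<close> even and \<open>u + v = y + y\<close> this is the two-term AM-GM form; it is written in
  expanded form because that is how it appears both in the AHI polynomial and in the definition of
  a circuit polynomial.
\<close>

definition amgm_form :: "'n expo \<Rightarrow> 'n expo \<Rightarrow> 'n expo \<Rightarrow> 'n mpoly" where
  "amgm_form u v y = mon u + mon v + const (-2) * mon y"

lemma lookup_amgm_form: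
  "Poly_Mapping.lookup (amgm_form u v y) a =
     (if a = u then 1 else 0) + (if a = v then 1 else 0) - (if a = y then 2 else 0)"
  by (simp add: amgm_form_def const_mult_mon lookup_add) (simp add: mon_def lookup_single when_def)

lemma peval_amgm_form: "peval (amgm_form u v y) x = mon_val u x + mon_val v x - 2 * mon_val y x"
  by (simp add: amgm_form_def peval_add peval_const_mult peval_mon)

lemma midpoint_of_halves:
  assumes "even_expo u" "even_expo v" "u + v = y + y"
  obtains a b where "u = a + a" "v = b + b" "y = a + b"
proof -
  obtain a b where ab: "u = a + a" "v = b + b"
    using assms(1,2) by (metis even_expo_half)
  then have "y + y = (a + b) + (a + b)"
    using assms(3) by (simp add: ac_simps)
  then show thesis
    using that ab expo_double_cancel by blast
qed

text \<open>
  Halving the exponents makes the midpoint the sum of the two halves, so the form is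
  \<open>(mon a - mon b)\<^sup>2\<close> with \<open>u = a + a\<close> and \<open>v = b + b\<close>.
\<close>

lemma amgm_form_square:
  assumes "even_expo u" "even_expo v" "u + v = y + y"
  shows "\<exists>q. amgm_form u v y = q\<^sup>2"
proof -
  obtain a b where [simp]: "u = a + a" "v = b + b" "y = a + b"
    using midpoint_of_halves[OF assms] .
  have "const (-2) = (- 2 :: 'a mpoly)"
    using const_add[of 1 1, where 'a = 'a] by (simp add: const_uminus)
  then have "amgm_form u v y = (mon a - mon b)\<^sup>2"
    by (simp add: amgm_form_def mon_add power2_eq_square algebra_simps)
  then show ?thesis ..
qed

lemma amgm_form_nonneg:
  assumes "even_expo u" "even_expo v" "u + v = y + y"
  shows "nonneg_poly (amgm_form u v y)"
  unfolding nonneg_poly_def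
proof
  fix x
  obtain a b where [simp]: "u = a + a" "v = b + b" "y = a + b"
    using midpoint_of_halves[OF assms] .
  have "peval (amgm_form u v y) x = (mon_val a x - mon_val b x)\<^sup>2"
    by (simp add: peval_amgm_form mon_val_add power2_eq_square algebra_simps)
  then show "peval (amgm_form u v y) x \<ge> 0" by simp
qed

text \<open>
  Two distinct exponents are affinely independent, their hull is a segment whose relative interior
  is the open segment, and that contains the midpoint. Distinctness is essential: otherwise the form
  is zero.
\<close>

lemma amgm_form_circuit:
  assumes "even_expo u" "even_expo v" "u + v = y + y" "u \<noteq> v"
  shows "circuit_poly (amgm_form u v y)"
proof -
  have ne: "expo_vec u \<noteq> expo_vec v"
    using \<open>u \<noteq> v\<close> by (auto simp: expo_vec_def vec_eq_iff intro: poly_mapping_eqI)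
  have "real (Poly_Mapping.lookup u i) + real (Poly_Mapping.lookup v i)
      = 2 * real (Poly_Mapping.lookup y i)" for i
    using arg_cong[OF assms(3), of "\<lambda>a. real (Poly_Mapping.lookup a i)"]
    by (simp add: lookup_add)
  then have "expo_vec y = midpoint (expo_vec u) (expo_vec v)"
    by (simp add: expo_vec_def midpoint_def vec_eq_iff)
  then have "expo_vec y \<in> open_segment (expo_vec u) (expo_vec v)"
    using ne by simp
  then have "expo_vec y \<in> rel_interior (convex hull (expo_vec ` {u, v}))"
    using ne rel_interior_closed_segment[of "expo_vec u" "expo_vec v"]
    by (simp add: segment_convex_hull)
  moreover have "\<not> affine_dependent (expo_vec ` {u, v})"
    by (simp add: affine_independent_2)
  moreover have "amgm_form u v y = (\<Sum>a\<in>{u, v}. const 1 * mon a) + const (-2) * mon y"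
    using \<open>u \<noteq> v\<close> by (simp add: amgm_form_def)
  ultimately show ?thesis
    unfolding circuit_poly_def using assms(1,2)
    by (intro disjI1 exI[of _ "{u, v}"] exI[of _ "\<lambda>_. 1"] exI[of _ "-2"] exI[of _ y]) auto
qed

section \<open>Sums over finite index sets in the two cones\<close>

lemma sum_of_squares_indexed:
  assumes "finite S" "\<And>s. s \<in> S \<Longrightarrow> \<exists>q. f s = q\<^sup>2"
  shows "\<exists>(k::nat) q. (\<Sum>s\<in>S. f s) = (\<Sum>j<k. (q j :: 'a::comm_ring_1)\<^sup>2)"
proof -
  obtain r where r: "f s = (r s)\<^sup>2" if "s \<in> S" for s
    using assms(2) by metis
  obtain h where h: "bij_betw h {..<card S} S"
    using ex_bij_betw_nat_finite[OF \<open>finite S\<close>] by (auto simp: lessThan_atLeast0)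
  have "(\<Sum>s\<in>S. f s) = (\<Sum>j<card S. f (h j))"
    using sum.reindex_bij_betw[OF h, of f] by simp
  also have "\<dots> = (\<Sum>j<card S. (r (h j))\<^sup>2)"
    using bij_betwE[OF h] r by (intro sum.cong) auto
  finally show ?thesis
    by (intro exI[of _ "card S"] exI[of _ "\<lambda>j. r (h j)"])
qed

lemma sonc_cone_sum:
  assumes "finite S"
    and w: "\<And>s. s \<in> S \<Longrightarrow> w s \<ge> 0"
    and g: "\<And>s. s \<in> S \<Longrightarrow> circuit_poly (g s) \<and> total_deg (g s) \<le> d \<and> nonneg_poly (g s)"
  shows "(\<Sum>s\<in>S. const (w s) * g s) \<in> sonc_cone d"
proof -
  obtain h where h: "bij_betw h {..<card S} S"
    using ex_bij_betw_nat_finite[OF \<open>finite S\<close>] by (auto simp: lessThan_atLeast0)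
  have "(\<Sum>s\<in>S. const (w s) * g s) = (\<Sum>j<card S. const (w (h j)) * g (h j))"
    using sum.reindex_bij_betw[OF h, of "\<lambda>s. const (w s) * g s"] by simp
  moreover have "\<forall>j<card S. w (h j) \<ge> 0 \<and> circuit_poly (g (h j)) \<and> total_deg (g (h j)) \<le> d
      \<and> nonneg_poly (g (h j))"
    using bij_betwE[OF h] w g by auto
  ultimately show ?thesis
    unfolding sonc_cone_def mem_Collect_eq
    by (intro exI[of _ "card S"] exI[of _ "\<lambda>j. w (h j)"] exI[of _ "\<lambda>j. g (h j)"] conjI)
qed

lemma const_mult_square:
  fixes q :: "'n mpoly"
  assumes "w \<ge> 0"
  shows "const w * q\<^sup>2 = (const (sqrt w) * q)\<^sup>2"
proof -
  have "const w = (const (sqrt w) :: 'n mpoly)\<^sup>2"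
    using assms by (simp add: power2_eq_square flip: const_mult)
  then show ?thesis by (simp add: power_mult_distrib)
qed

lemma mon_even_square:
  assumes "even_expo a"
  shows "\<exists>q. mon a = q\<^sup>2"
  using even_expo_half[OF assms] mon_add by (metis power2_eq_square)

lemma mon_even_nonneg:
  assumes "even_expo a"
  shows "nonneg_poly (mon a)"
proof -
  obtain h where "a = h + h" using even_expo_half[OF assms] .
  then show ?thesis
    by (simp add: nonneg_poly_def peval_mon mon_val_add)
qed

section \<open>Segments with a common midpoint\<close>

text \<open>
  All forms below share the midpoint \<open>y\<close>, so cancellation between summands happens at \<open>y\<close> only;
  this is what turns a degree bound on the sum into degree bounds on the summands.
\<close>

locale common_midpoint =
  fixes T :: "'t set" and w :: "'t \<Rightarrow> real" and u v :: "'t \<Rightarrow> 'n::finite expo"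
    and y :: "'n expo" and b :: real and p :: "'n mpoly"
  assumes finite_T: "finite T"
    and w: "\<And>t. t \<in> T \<Longrightarrow> w t \<ge> 0"
    and even_u: "\<And>t. t \<in> T \<Longrightarrow> even_expo (u t)"
    and even_v: "\<And>t. t \<in> T \<Longrightarrow> even_expo (v t)"
    and mid: "\<And>t. t \<in> T \<Longrightarrow> u t + v t = y + y"
    and even_y: "even_expo y"
    and b: "b \<ge> 0"
    and p: "p = (\<Sum>t\<in>T. const (w t) * amgm_form (u t) (v t) y) + const b * mon y"
begin

lemma sum_of_squares: "\<exists>(k::nat) q. p = (\<Sum>j<k. (q j)\<^sup>2)"
proof -
  \<comment> \<open>The leftover multiple of the midpoint monomial is indexed by \<open>None\<close>.\<close>
  let ?f = "case_option (const b * mon y) (\<lambda>t. const (w t) * amgm_form (u t) (v t) y)"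
  have "p = (\<Sum>s\<in>insert None (Some ` T). ?f s)"
    using finite_T by (simp add: p sum.reindex add.commute)
  moreover have "\<exists>q. ?f s = q\<^sup>2" if "s \<in> insert None (Some ` T)" for s
  proof (cases s)
    case None
    obtain q where "mon y = q\<^sup>2"
      using mon_even_square[OF even_y] by blast
    then show ?thesis
      using None const_mult_square[OF b] by auto
  next
    case (Some t)
    with that have t: "t \<in> T" by auto
    obtain q where "amgm_form (u t) (v t) y = q\<^sup>2"
      using amgm_form_square[OF even_u[OF t] even_v[OF t] mid[OF t]] by blast
    then show ?thesis
      using Some const_mult_square[OF w[OF t]] by auto
  qed
  ultimately show ?thesis
    using sum_of_squares_indexed[of "insert None (Some ` T)" ?f] finite_T by simp
qed

lemma lookup_p:
  "Poly_Mapping.lookup p a =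
     (\<Sum>t\<in>T. w t * Poly_Mapping.lookup (amgm_form (u t) (v t) y) a) + (if a = y then b else 0)"
  by (simp add: p lookup_add lookup_sum lookup_const_mult)
    (simp add: mon_def lookup_single when_def)

lemma end_ne_mid:
  assumes "t \<in> T" "u t \<noteq> v t"
  shows "u t \<noteq> y" "v t \<noteq> y"
  using mid[OF assms(1)] assms(2) by auto

text \<open>Away from \<open>y\<close> every form has non-negative coefficients, so nothing cancels.\<close>

lemma ends_in_keys:
  assumes t: "t \<in> T" and pos: "w t > 0" and ne: "u t \<noteq> v t" and a: "a \<in> {u t, v t}"
  shows "a \<in> Poly_Mapping.keys p"
proof -
  have "a \<noteq> y" using end_ne_mid[OF t ne] a by auto
  have "0 < w t * Poly_Mapping.lookup (amgm_form (u t) (v t) y) a"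
    using a pos \<open>a \<noteq> y\<close> by (auto simp: lookup_amgm_form)
  also have "\<dots> \<le> (\<Sum>s\<in>T. w s * Poly_Mapping.lookup (amgm_form (u s) (v s) y) a)"
    using \<open>a \<noteq> y\<close> by (intro member_le_sum) (auto simp: lookup_amgm_form t finite_T w)
  finally show ?thesis
    using \<open>a \<noteq> y\<close> by (simp add: in_keys_iff lookup_p)
qed

lemma proper_segment_degrees:
  assumes t: "t \<in> T" and pos: "w t > 0" and ne: "u t \<noteq> v t"
  shows "expo_deg (u t) \<le> total_deg p" "expo_deg (v t) \<le> total_deg p" "expo_deg y \<le> total_deg p"
proof -
  show 1: "expo_deg (u t) \<le> total_deg p" "expo_deg (v t) \<le> total_deg p"
    using ends_in_keys[OF assms] by (auto intro: expo_deg_le_total_deg)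
  have "expo_deg (u t) + expo_deg (v t) = expo_deg y + expo_deg y"
    using mid[OF t] by (metis expo_deg_add)
  with 1 show "expo_deg y \<le> total_deg p" by linarith
qed

text \<open>
  If the coefficient of \<open>p\<close> at \<open>y\<close> vanishes although \<open>b > 0\<close>, some proper segment with positive
  weight must have contributed a negative amount there.
\<close>

lemma midpoint_degree:
  assumes "b > 0"
  shows "expo_deg y \<le> total_deg p"
proof (cases "\<exists>t\<in>T. w t > 0 \<and> u t \<noteq> v t")
  case True
  then show ?thesis using proper_segment_degrees(3) by blast
next
  case False
  have "w t * Poly_Mapping.lookup (amgm_form (u t) (v t) y) y = 0" if "t \<in> T" for t
  proof (cases "u t = v t")
    case True
    then have "u t = y" using mid[OF that] expo_double_cancel by metis
    with True show ?thesis by (simp add: lookup_amgm_form)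
  next
    case ne: False
    then have "w t = 0" using False that w[OF that] by force
    then show ?thesis by simp
  qed
  then have "(\<Sum>t\<in>T. w t * Poly_Mapping.lookup (amgm_form (u t) (v t) y) y) = 0"
    by (intro sum.neutral) blast
  then have "Poly_Mapping.lookup p y = b"
    by (simp add: lookup_p)
  then show ?thesis
    using assms by (intro expo_deg_le_total_deg) (simp add: in_keys_iff)
qed

lemma in_sonc_cone:
  assumes "total_deg p \<le> d"
  shows "p \<in> sonc_cone d"
proof -
  \<comment> \<open>Only proper segments with positive weight are sure to obey the degree bound; the other forms
      are zero or carry weight zero, so they are dropped. Likewise the midpoint monomial, indexed by
      \<open>None\<close>, is kept only if its weight is positive.\<close>
  define T' where "T' = {t \<in> T. w t > 0 \<and> u t \<noteq> v t}"
  define S where "S = (if b > 0 then {None} else {}) \<union> Some ` T'"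
  define g where "g = case_option (mon y) (\<lambda>t. amgm_form (u t) (v t) y)"
  define m where "m = case_option b w"
  have fin: "finite T'" "finite S"
    using finite_T by (auto simp: T'_def S_def)
  have "const (w t) * amgm_form (u t) (v t) y = 0" if "t \<in> T - T'" for t
  proof (cases "u t = v t")
    case True
    then have "u t = y" using mid[of t] that expo_double_cancel by (metis DiffD1)
    with True have "amgm_form (u t) (v t) y = 0"
      by (intro poly_mapping_eqI) (simp add: lookup_amgm_form)
    then show ?thesis by simp
  next
    case False
    then have "w t = 0" using that w[of t] by (force simp: T'_def)
    then show ?thesis by simp
  qed
  then have "(\<Sum>t\<in>T. const (w t) * amgm_form (u t) (v t) y)
      = (\<Sum>t\<in>T'. const (w t) * amgm_form (u t) (v t) y)"
    using finite_T by (intro sum.mono_neutral_right) (auto simp: T'_def)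
  also have "\<dots> + const b * mon y = (\<Sum>s\<in>S. const (m s) * g s)"
  proof (cases "b > 0")
    case True
    then show ?thesis
      using fin by (simp add: S_def g_def m_def sum.reindex add.commute)
  next
    case False
    with b have "b = 0" by simp
    then show ?thesis
      by (simp add: S_def g_def m_def sum.reindex)
  qed
  finally have "p = (\<Sum>s\<in>S. const (m s) * g s)"
    by (simp add: p)
  moreover have "(\<Sum>s\<in>S. const (m s) * g s) \<in> sonc_cone d"
  proof (rule sonc_cone_sum[OF fin(2)])
    fix s assume s: "s \<in> S"
    show "m s \<ge> 0"
      using s b w by (cases s) (auto simp: S_def m_def T'_def split: if_splits)
    show "circuit_poly (g s) \<and> total_deg (g s) \<le> d \<and> nonneg_poly (g s)"
    proof (cases s)
      case None
      with s have "b > 0" by (auto simp: S_def split: if_splits)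
      have "circuit_poly (mon y)"
        unfolding circuit_poly_def
        by (intro disjI2 exI[of _ y] exI[of _ 1]) (simp add: even_y)
      moreover have "total_deg (mon y) \<le> d"
        using midpoint_degree[OF \<open>b > 0\<close>] assms
        by (intro total_deg_le) (simp add: mon_def)
      ultimately show ?thesis
        using None mon_even_nonneg[OF even_y] by (simp add: g_def)
    next
      case (Some t)
      with s have t: "t \<in> T" "w t > 0" "u t \<noteq> v t"
        by (auto simp: S_def T'_def split: if_splits)
      have "a \<in> {u t, v t, y}"
        if "a \<in> Poly_Mapping.keys (amgm_form (u t) (v t) y)" for a
        using that by (auto simp: in_keys_iff lookup_amgm_form split: if_splits)
      then have "total_deg (amgm_form (u t) (v t) y) \<le> d"
        using proper_segment_degrees[OF t] assms by (intro total_deg_le) fastforce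
      then show ?thesis
        using Some t amgm_form_circuit[OF even_u even_v mid] amgm_form_nonneg[OF even_u even_v mid]
        by (simp add: g_def)
    qed
  qed
  ultimately show ?thesis by simp
qed

end

section \<open>The decomposition of an AHI polynomial\<close>

definition AHI_end :: "('n::finite \<Rightarrow> 'n expo) \<Rightarrow> 'n \<Rightarrow> 'n \<Rightarrow> 'n expo" where
  "AHI_end \<alpha> i k = \<alpha> i + (\<Sum>j\<in>UNIV - {k}. \<alpha> j)"

lemma AHI_end_midpoint:
  "AHI_end \<alpha> i k + AHI_end \<alpha> k i = (\<Sum>j\<in>UNIV. \<alpha> j) + (\<Sum>j\<in>UNIV. \<alpha> j)"
proof -
  have "(\<Sum>j\<in>UNIV. \<alpha> j) = \<alpha> m + (\<Sum>j\<in>UNIV - {m}. \<alpha> j)" for m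
    by (simp add: sum.remove)
  from this[of i] this[of k]
  have "(\<Sum>j\<in>UNIV. \<alpha> j) + (\<Sum>j\<in>UNIV. \<alpha> j)
      = (\<alpha> i + (\<Sum>j\<in>UNIV - {i}. \<alpha> j)) + (\<alpha> k + (\<Sum>j\<in>UNIV - {k}. \<alpha> j))"
    by (rule arg_cong2)
  also have "\<dots> = AHI_end \<alpha> i k + AHI_end \<alpha> k i"
    unfolding AHI_end_def by (simp only: ac_simps)
  finally show ?thesis ..
qed

text \<open>
  The product contributes \<open>l i * l k\<close> at \<open>AHI_end \<alpha> i k\<close>. Averaging over the swap of \<open>i\<close> and \<open>k\<close>
  explains the factor \<open>1/2\<close>; the subtracted midpoint terms add up to \<open>(\<Sum>i. l i)\<^sup>2\<close>, which the last
  summand restores.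
\<close>

lemma AHI_decomposition:
  fixes \<alpha> :: "'n::finite \<Rightarrow> 'n expo" and l :: "'n \<Rightarrow> real"
  defines "y \<equiv> \<Sum>j\<in>UNIV. \<alpha> j"
  shows "(\<Sum>i\<in>UNIV. const (l i) * mon (\<alpha> i))
           * (\<Sum>i\<in>UNIV. const (l i) * (\<Prod>j\<in>UNIV - {i}. mon (\<alpha> j)))
         - const c * (\<Prod>i\<in>UNIV. mon (\<alpha> i))
       = (\<Sum>(i, k)\<in>UNIV \<times> UNIV.
            const (l i * l k / 2) * amgm_form (AHI_end \<alpha> i k) (AHI_end \<alpha> k i) y)
         + const ((\<Sum>i\<in>UNIV. l i)\<^sup>2 - c) * mon y"
proof -
  let ?E = "\<lambda>i k. mon (AHI_end \<alpha> i k)"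
  have halves: "const (x / 2) * E + const (x / 2) * E = const x * E" for x and E :: "'n mpoly"
    by (simp flip: distrib_right const_add)
  have swap: "(\<Sum>i\<in>UNIV. \<Sum>k\<in>UNIV. const (l i * l k / 2) * ?E k i)
      = (\<Sum>i\<in>UNIV. \<Sum>k\<in>UNIV. const (l i * l k / 2) * ?E i k)"
    by (subst sum.swap) (simp add: mult.commute)
  have "(\<Sum>i\<in>UNIV. \<Sum>k\<in>UNIV. const (l i * l k / 2) * (?E i k + ?E k i))
      = (\<Sum>i\<in>UNIV. \<Sum>k\<in>UNIV. const (l i * l k / 2) * ?E i k)
        + (\<Sum>i\<in>UNIV. \<Sum>k\<in>UNIV. const (l i * l k / 2) * ?E k i)"
    by (simp only: distrib_left sum.distrib)
  also have "\<dots> = (\<Sum>i\<in>UNIV. \<Sum>k\<in>UNIV.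
      const (l i * l k / 2) * ?E i k + const (l i * l k / 2) * ?E i k)"
    unfolding swap by (simp only: sum.distrib)
  also have "\<dots> = (\<Sum>i\<in>UNIV. \<Sum>k\<in>UNIV. const (l i * l k) * ?E i k)"
    by (intro sum.cong refl halves)
  finally have ends: "(\<Sum>i\<in>UNIV. \<Sum>k\<in>UNIV. const (l i * l k / 2) * (?E i k + ?E k i))
      = (\<Sum>i\<in>UNIV. \<Sum>k\<in>UNIV. const (l i * l k) * ?E i k)" .
  have square: "- (\<Sum>i\<in>UNIV. l i)\<^sup>2 = (\<Sum>i\<in>UNIV. \<Sum>k\<in>UNIV. l i * l k / 2 * (- 2))"
    unfolding power2_eq_square sum_product by (simp add: sum_negf)
  have mids: "(\<Sum>i\<in>UNIV. \<Sum>k\<in>UNIV. const (l i * l k / 2) * (const (- 2) * mon y))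
      = const (- (\<Sum>i\<in>UNIV. l i)\<^sup>2) * mon y"
    unfolding square const_sum sum_distrib_right by (simp only: const_mult mult.assoc)
  have "const (- (\<Sum>i\<in>UNIV. l i)\<^sup>2) * mon y + const ((\<Sum>i\<in>UNIV. l i)\<^sup>2 - c) * mon y
      = const (- c) * mon y"
    by (simp flip: distrib_right const_add)
  then have cP: "- (const c * (\<Prod>i\<in>UNIV. mon (\<alpha> i))) = const (- (\<Sum>i\<in>UNIV. l i)\<^sup>2) * mon y
      + const ((\<Sum>i\<in>UNIV. l i)\<^sup>2 - c) * mon y"
    by (simp add: const_uminus y_def mon_sum)
  have "(\<Sum>i\<in>UNIV. const (l i) * mon (\<alpha> i))
           * (\<Sum>i\<in>UNIV. const (l i) * (\<Prod>j\<in>UNIV - {i}. mon (\<alpha> j)))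
      = (\<Sum>i\<in>UNIV. \<Sum>k\<in>UNIV. const (l i * l k) * ?E i k)"
    unfolding sum_product AHI_end_def mon_add mon_sum const_mult
    by (simp add: ac_simps)
  also have "\<dots> - const c * (\<Prod>i\<in>UNIV. mon (\<alpha> i))
      = (\<Sum>i\<in>UNIV. \<Sum>k\<in>UNIV. const (l i * l k / 2) * (?E i k + ?E k i))
        + const (- (\<Sum>i\<in>UNIV. l i)\<^sup>2) * mon y + const ((\<Sum>i\<in>UNIV. l i)\<^sup>2 - c) * mon y"
    unfolding diff_conv_add_uminus[of _ "const c * _"] cP ends by (simp only: add.assoc)
  also have "\<dots> = (\<Sum>i\<in>UNIV. \<Sum>k\<in>UNIV.
            const (l i * l k / 2) * amgm_form (AHI_end \<alpha> i k) (AHI_end \<alpha> k i) y)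
         + const ((\<Sum>i\<in>UNIV. l i)\<^sup>2 - c) * mon y"
    unfolding mids[symmetric] amgm_form_def by (simp only: distrib_left sum.distrib)
  finally show ?thesis
    by (simp add: sum.cartesian_product)
qed

theorem corollary4p2:
  fixes p :: "'n::finite mpoly" and D :: nat
  assumes "AHI p"
    and "nonneg_poly p"
    and "total_deg p \<le> 2 * D"
  shows "p \<in> sos_cone (2 * D) \<inter> sonc_cone (2 * D)"
proof -
  obtain l c and \<alpha> :: "'n \<Rightarrow> 'n expo" where l: "\<And>i. l i \<ge> 0" and even: "\<And>i. even_expo (\<alpha> i)"
    and p_AHI: "p = (\<Sum>i\<in>UNIV. const (l i) * mon (\<alpha> i))
           * (\<Sum>i\<in>UNIV. const (l i) * (\<Prod>j\<in>UNIV - {i}. mon (\<alpha> j)))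
         - const c * (\<Prod>i\<in>UNIV. mon (\<alpha> i))"
    using \<open>AHI p\<close> unfolding AHI_def by blast
  define y where "y = (\<Sum>j\<in>UNIV. \<alpha> j)"
  define w where "w = (\<lambda>(i, k). l i * l k / 2)"
  define u where "u = (\<lambda>(i, k). AHI_end \<alpha> i k)"
  define v where "v = (\<lambda>(i, k). AHI_end \<alpha> k i)"
  define b where "b = (\<Sum>i\<in>UNIV. l i)\<^sup>2 - c"
  have p: "p = (\<Sum>t\<in>UNIV \<times> UNIV. const (w t) * amgm_form (u t) (v t) y) + const b * mon y"
    unfolding p_AHI AHI_decomposition y_def w_def u_def v_def b_def
    by (simp add: case_prod_beta)
  \<comment> \<open>At the all-ones point each form evaluates to \<open>1 + 1 - 2 = 0\<close>.\<close>
  have "peval p (\<chi> i. 1) = b"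
    by (simp add: p peval_add peval_sum peval_const_mult peval_amgm_form peval_mon)
  then have "b \<ge> 0"
    using \<open>nonneg_poly p\<close> unfolding nonneg_poly_def by metis
  interpret common_midpoint "UNIV \<times> UNIV" w u v y b p
  proof
    show "u t + v t = y + y" for t
      by (simp add: u_def v_def y_def AHI_end_midpoint case_prod_beta)
    show "even_expo (u t)" "even_expo (v t)" for t
      by (simp_all add: u_def v_def AHI_end_def case_prod_beta even even_expo_add even_expo_sum)
    show "even_expo y"
      by (simp add: y_def even even_expo_sum)
    show "w t \<ge> 0" for t
      by (simp add: w_def case_prod_beta l)
  qed (use p \<open>b \<ge> 0\<close> in auto)
  show ?thesis
    using sum_of_squares in_sonc_cone assms(3) by (simp add: sos_cone_def)
qed

end
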